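(* With $t_m=m(m+1)/2$ denoting the $m$-th triangular number, the following hold. \begin{itemize} \item $g(t_n,t_{n+1},t_{n+2};3)=\frac{(5 n+3)(n+1)(n+2)}{4}-1$ if $n\ge 3$ is odd, and $=\frac{(5 n+6)(n+1)(n+2)}{4}-1$ if $n\ge 6$ is even. \item For $n=5$ and for all $n\ge 7$: $g(t_n,t_{n+1},t_{n+2};4)=\frac{3 n(n+1)(n+2)}{2}-1$. \item For $n=6$ and for all $n\ge 8$: $g(t_n,t_{n+1},t_{n+2};5)=\frac{3(n+1)^2(n+2)}{2}-1$. \item $g(t_n,t_{n+1},t_{n+2};6)=\frac{(7 n-3)(n+1)(n+2)}{4}-1$ if $n\ge 11$ is odd, and $=\frac{7 n(n+1)(n+2)}{4}-1$ if $n\ge 8$ is even. \item $g(t_n,t_{n+1},t_{n+2};7)=\frac{(7 n+3)(n+1)(n+2)}{4}-1$ if $n\ge 5$ is odd, and $=\frac{(7 n+6)(n+1)(n+2)}{4}-1$ if $n\ge 6$ is even. \item $g(t_n,t_{n+1},t_{n+2};8)=\frac{(7 n+9)(n+1)(n+2)}{4}-1$ if $n\ge 9$ is odd, and $=\frac{(7 n+12)(n+1)(n+2)}{4}-1$ if $n\ge 12$ is even. \item For $n=11$ and for all $n\ge 13$: $g(t_n,t_{n+1},t_{n+2};9)=2 n(n+1)(n+2)-1$. \item For $n=3$, $n=4$ and for all $n\ge 8$: $g(t_n,t_{n+1},t_{n+2};10)=\frac{(4 n+3)(n+1)(n+2)}{2}-1$. \end{itemize}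
   Context: For positive integers $a_1,\dots,a_k$ with $\gcd(a_1,\dots,a_k)=1$ and an integer $N$, let $d(N;a_1,\dots,a_k)$ denote the number of $k$-tuples $(x_1,\dots,x_k)$ of nonnegative integers with $a_1x_1+\cdots+a_kx_k=N$. For a nonnegative integer $q$, $g(a_1,\dots,a_k;q)$ denotes the largest integer $N$ such that $d(N;a_1,\dots,a_k)\le q$. It is known that $\gcd(t_n,t_{n+1},t_{n+2})=1$. *)

theory Defs
  imports Complex_Main
begin

(* For positive as the set below is finite, so that card is the true count. *)
definition denumerant :: "int \<Rightarrow> nat list \<Rightarrow> nat" where
  "denumerant N as =
     card {xs :: nat list. length xs = length as \<and> int (\<Sum>i<length as. as ! i * xs ! i) = N}"

(* N ranges over all integers, and denumerant N as = 0 for N < 0.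
   GREATEST is unspecified when no largest N exists. *)
definition frobenius :: "nat list \<Rightarrow> nat \<Rightarrow> int" where
  "frobenius as q = (GREATEST N. denumerant N as \<le> q)"

definition triangular :: "nat \<Rightarrow> nat" where
  "triangular m = m * (m + 1) div 2"

end

theory Submission
  imports Defs
begin

text \<open>
  The three consecutive triangular numbers have the form \<open>a = s r\<close>, \<open>b = p r\<close>, \<open>c = p t\<close>, and
  \<open>a + c = 2 b + 1\<close> makes \<open>a \<equiv> 1\<close> modulo \<open>p\<close>, \<open>c \<equiv> 1\<close> modulo \<open>r\<close>, and \<open>p\<close>, \<open>r\<close> coprime.
  In a solution of \<open>a x + b y + c z = N\<close> the residues \<open>x mod p\<close> and \<open>z mod r\<close> are therefore those
  of \<open>N\<close>. Writing \<open>x = x\<^sub>0 + p i\<close>, \<open>z = z\<^sub>0 + r j\<close> and \<open>N = a x\<^sub>0 + c z\<^sub>0 + b K\<close>, the equation becomes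
  \<open>s i + y + t j = K\<close>, so the denumerant counts the pairs \<open>(i, j)\<close> with \<open>s i + t j \<le> K\<close>. The worst
  residues are \<open>x\<^sub>0 = p - 1\<close>, \<open>z\<^sub>0 = r - 1\<close>, and \<open>K + 1\<close> is then the entry of index \<open>q\<close>, counted
  from 0, in the sorted list of the values \<open>s i + t j\<close>.
\<close>

section \<open>Solutions of a single equation as weighted pairs\<close>

lemma finite_weighted_pairs:
  fixes s t :: nat and K :: int
  assumes "0 < s" "0 < t"
  shows "finite {(i, j). int (s * i + t * j) \<le> K}"
proof (rule finite_subset)
  show "{(i, j). int (s * i + t * j) \<le> K} \<subseteq> {..nat K} \<times> {..nat K}"
  proof (rule subrelI)
    fix i j assume "(i, j) \<in> {(i, j). int (s * i + t * j) \<le> K}"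
    then have "int (s * i + t * j) \<le> K" by simp
    moreover have "i \<le> s * i" "j \<le> t * j" using assms by auto
    ultimately have "i \<le> nat K" "j \<le> nat K" by linarith+
    then show "(i, j) \<in> {..nat K} \<times> {..nat K}" by simp
  qed
qed simp

text \<open>The bound \<open>x0 < p\<close> makes \<open>x0\<close> the least natural number of its
  class modulo \<open>p\<close>, so the quotient is itself a natural number.\<close>

lemma int_eq_add_multE:
  fixes x x0 p :: nat
  assumes "int p dvd int x - int x0" "x0 < p"
  obtains i where "x = x0 + p * i"
proof -
  have "int x mod int p = int x0 mod int p" using assms(1) by (simp add: mod_eq_dvd_iff)
  then have "x mod p = x0" using assms(2) by (metis mod_less of_nat_eq_iff zmod_int)
  then have "x = x0 + p * (x div p)" by (metis mod_mult_div_eq)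
  then show ?thesis using that by blast
qed

lemma unit_combination_int:
  fixes s t p r :: nat
  assumes "s * r + p * t = 2 * p * r + 1"
  shows "int s * int r + int p * int t - 2 * int p * int r = 1"
  using arg_cong[OF assms, of int] by simp

text \<open>\<open>a\<close> is a unit modulo \<open>p\<close> and can be cancelled from
  \<open>a * d\<close>.\<close>

lemma dvd_of_unit_combination:
  fixes a b p c d :: int
  assumes "a + p * b = 1" "a * d = p * c"
  shows "p dvd d"
proof -
  have "d = (a + p * b) * d" using assms(1) by simp
  also have "\<dots> = p * (c + b * d)" using assms(2) by (simp add: algebra_simps)
  finally show ?thesis by (rule dvdI)
qed

lemma denumerant_eq_card_pairs:
  fixes s t p r x0 z0 :: nat and K :: int
  assumes rel: "s * r + p * t = 2 * p * r + 1" and x0: "x0 < p" and z0: "z0 < r"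
  shows "denumerant (int (s * r) * int x0 + int (p * t) * int z0 + int (p * r) * K)
           [s * r, p * r, p * t] = card {(i, j). int (s * i + t * j) \<le> K}"
    (is "denumerant ?N ?as = card ?P")
proof -
  \<comment> \<open>The middle entry is the value of \<open>y\<close> forced by \<open>i\<close> and
    \<open>j\<close>. It is nonnegative exactly on \<open>?P\<close>, so \<open>nat\<close>
    truncates nothing there.\<close>
  let ?f = "\<lambda>(i, j). [x0 + p * i, nat (K - int (s * i + t * j)), z0 + r * j]"
  let ?X = "{xs :: nat list. length xs = length ?as \<and> int (\<Sum>i<length ?as. ?as ! i * xs ! i) = ?N}"
  note relZ = unit_combination_int[OF rel]
  have "inj_on ?f ?P" using x0 z0 by (auto simp: inj_on_def)
  moreover have "?f ` ?P = ?X"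
  proof (intro equalityI subsetI)
    fix xs assume "xs \<in> ?f ` ?P"
    then show "xs \<in> ?X" by (auto simp: algebra_simps numeral_3_eq_3)
  next
    fix xs assume "xs \<in> ?X"
    then obtain x y z where xs: "xs = [x, y, z]"
      and eq: "int s * int r * int x + int p * int r * int y + int p * int t * int z = ?N"
      by (auto simp: numeral_3_eq_3 length_Suc_conv)
    \<comment> \<open>With the \<open>x\<close> terms isolated, every other term carries the factor
      \<open>p\<close>; below, the \<open>z\<close> terms are isolated in the same way modulo
      \<open>r\<close>.\<close>
    have "int s * int r * (int x - int x0)
        = int p * (int t * int z0 + int r * K - int r * int y - int t * int z)"
      using eq by (simp add: algebra_simps)
    moreover have "int s * int r + int p * (int t - 2 * int r) = 1"
      using relZ by (simp add: algebra_simps)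
    ultimately have "int p dvd int x - int x0" by (rule dvd_of_unit_combination[rotated])
    then obtain i where i: "x = x0 + p * i" using int_eq_add_multE x0 by blast
    have "int p * int t * (int z - int z0)
        = int r * (int s * int x0 + int p * K - int p * int y - int s * int x)"
      using eq by (simp add: algebra_simps)
    moreover have "int p * int t + int r * (int s - 2 * int p) = 1"
      using relZ by (simp add: algebra_simps)
    ultimately have "int r dvd int z - int z0" by (rule dvd_of_unit_combination[rotated])
    then obtain j where j: "z = z0 + r * j" using int_eq_add_multE z0 by blast
    have "int p * int r * (int s * int i + int y + int t * int j) = int p * int r * K"
      using eq unfolding i j by (simp add: algebra_simps)
    then have "int s * int i + int y + int t * int j = K" using x0 z0 by simp
    then have "(i, j) \<in> ?P" "xs = ?f (i, j)" by (auto simp: xs i j)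
    then show "xs \<in> ?f ` ?P" by blast
  qed
  ultimately show ?thesis unfolding denumerant_def by (metis (no_types, lifting) card_image)
qed

section \<open>From the counts to the largest \<open>N\<close>\<close>

lemma int_residue_representation:
  fixes s t p r :: nat and N :: int
  assumes rel: "s * r + p * t = 2 * p * r + 1" and "0 < p" "0 < r"
  obtains x0 z0 K where "x0 < p" "z0 < r"
    "N = int (s * r) * int x0 + int (p * t) * int z0 + int (p * r) * K"
proof -
  note relZ = unit_combination_int[OF rel]
  define x0 where "x0 = nat (N mod int p)"
  define z0 where "z0 = nat (N mod int r)"
  define u where "u = N div int p"
  define v where "v = N div int r"
  have x0: "x0 < p" "N = int p * u + int x0"
    using assms by (auto simp: x0_def u_def nat_less_iff)
  have z0: "z0 < r" "N = int r * v + int z0"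
    using assms by (auto simp: z0_def v_def nat_less_iff)
  \<comment> \<open>\<open>N\<close> is multiplied by a combination equal to 1. Expanding it as
    \<open>p u + x0\<close> in the first term and as \<open>r v + z0\<close> in the second leaves a
    multiple of \<open>p r\<close>, which supplies \<open>K = s u + t v - 2 N\<close>.\<close>
  have "N = (int s * int r + int p * int t - 2 * int p * int r) * N"
    unfolding relZ by simp
  also have "\<dots> = int s * int r * N + int p * int t * N - 2 * int p * int r * N"
    by (simp add: algebra_simps)
  also have "int s * int r * N = int s * int r * (int p * u + int x0)"
    by (simp only: x0(2)[symmetric])
  also have "int p * int t * N = int p * int t * (int r * v + int z0)"
    by (simp only: z0(2)[symmetric])
  finally have "N = int (s * r) * int x0 + int (p * t) * int z0
      + int (p * r) * (int s * u + int t * v - 2 * N)"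
    by (simp add: algebra_simps)
  with x0(1) z0(1) show ?thesis using that by blast
qed

text \<open>The two counts place \<open>V\<close> at index \<open>q\<close> of the sorted values, so
  a denumerant of at most \<open>q\<close> forces \<open>K < V\<close>. The maximum takes
  \<open>K = V - 1\<close> and the largest residues.\<close>

lemma frobenius_eqI:
  fixes s t p r V q :: nat
  assumes rel: "s * r + p * t = 2 * p * r + 1"
    and pos: "0 < s" "0 < t" "0 < p" "0 < r"
    and below: "card {(i, j). s * i + t * j < V} \<le> q"
    and upto: "q < card {(i, j). s * i + t * j \<le> V}"
  shows "frobenius [s * r, p * r, p * t] q
           = int (p * r) * (int s + int t + int V - 3) - 1"
    (is "_ = ?G")
  unfolding frobenius_def
proof (rule Greatest_equality)
  note relZ = unit_combination_int[OF rel]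
  \<comment> \<open>The largest residues subtract \<open>s r + p t = 2 p r + 1\<close>, which
    together with \<open>V - 1\<close> gives the \<open>- 3\<close> and the final
    \<open>- 1\<close>.\<close>
  have G: "?G = int (s * r) * int (p - 1) + int (p * t) * int (r - 1) + int (p * r) * (int V - 1)"
    using pos relZ by (simp add: algebra_simps of_nat_diff)
  have "denumerant ?G [s * r, p * r, p * t] = card {(i, j). int (s * i + t * j) \<le> int V - 1}"
    unfolding G by (rule denumerant_eq_card_pairs[OF rel]) (use pos in auto)
  also have "{(i, j). int (s * i + t * j) \<le> int V - 1} = {(i, j). s * i + t * j < V}"
    by (simp only: zle_diff1_eq of_nat_less_iff)
  finally show "denumerant ?G [s * r, p * r, p * t] \<le> q" using below by simp
  fix N assume N: "denumerant N [s * r, p * r, p * t] \<le> q"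
  obtain x0 z0 K where xz: "x0 < p" "z0 < r"
    and NK: "N = int (s * r) * int x0 + int (p * t) * int z0 + int (p * r) * K"
    using int_residue_representation[OF rel pos(3,4)] .
  have card: "card {(i, j). int (s * i + t * j) \<le> K} \<le> q"
    using N denumerant_eq_card_pairs[OF rel xz, of K] NK by simp
  have "K \<le> int V - 1"
  proof (rule ccontr)
    assume "\<not> K \<le> int V - 1"
    then have "int (s * i + t * j) \<le> K" if "s * i + t * j \<le> V" for i j
      using that by linarith
    then have "{(i, j). s * i + t * j \<le> V} \<subseteq> {(i, j). int (s * i + t * j) \<le> K}" by blast
    then have "card {(i, j). s * i + t * j \<le> V} \<le> card {(i, j). int (s * i + t * j) \<le> K}"
      by (intro card_mono finite_weighted_pairs pos)
    with card upto show False by simp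
  qed
  then show "N \<le> ?G" unfolding NK G using xz by (intro add_mono mult_left_mono) auto
qed

text \<open>
  With \<open>V = s k + t l\<close> the value of index \<open>q\<close>, \<open>F\<close> lists the \<open>q\<close> pairs preceding \<open>(k, l)\<close>; ties with
  \<open>V\<close> may appear in \<open>F\<close> or be left out.
\<close>

lemma frobenius_eqI_list:
  fixes s t p r q a b k l :: nat and F :: "(nat \<times> nat) list"
  assumes rel: "s * r + p * t = 2 * p * r + 1"
    and pos: "0 < s" "0 < t" "0 < p" "0 < r"
    and bounds: "s * k + t * l \<le> s * a" "s * k + t * l \<le> t * b"
    and below: "list_all (\<lambda>i. list_all (\<lambda>j. s * i + t * j < s * k + t * l \<longrightarrow> (i, j) \<in> set F)
                  [0..<b]) [0..<a]"
    and upto: "list_all (\<lambda>(i, j). s * i + t * j \<le> s * k + t * l) F"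
    and F: "distinct ((k, l) # F)" "length F = q"
  shows "frobenius [s * r, p * r, p * t] q
           = int (p * r) * (int s + int t + int (s * k + t * l) - 3) - 1"
proof (rule frobenius_eqI[OF rel pos])
  let ?V = "s * k + t * l"
  have "{(i, j). s * i + t * j < ?V} \<subseteq> set F"
  proof clarify
    fix i j assume *: "s * i + t * j < ?V"
    \<comment> \<open>The bounds confine these pairs to the box \<open>i < a\<close>,
      \<open>j < b\<close>, on which \<open>below\<close> is a finite check.\<close>
    then have "s * i < s * a" "t * j < t * b" using bounds by linarith+
    with * below show "(i, j) \<in> set F" by (auto simp: list_all_iff)
  qed
  then have "card {(i, j). s * i + t * j < ?V} \<le> card (set F)" by (intro card_mono) auto
  also have "\<dots> \<le> q" using F(2) card_length by blast
  finally show "card {(i, j). s * i + t * j < ?V} \<le> q" .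
  have "finite {(i, j). s * i + t * j \<le> ?V}"
    using finite_weighted_pairs[OF pos(1,2), of "int ?V"] by (simp only: of_nat_le_iff)
  moreover have "set ((k, l) # F) \<subseteq> {(i, j). s * i + t * j \<le> ?V}"
    using upto by (auto simp: list_all_iff)
  ultimately have "card (set ((k, l) # F)) \<le> card {(i, j). s * i + t * j \<le> ?V}"
    by (rule card_mono)
  then show "q < card {(i, j). s * i + t * j \<le> ?V}"
    using distinct_card[OF F(1)] F(2) by simp
qed

section \<open>Factored triangular numbers and the two parities\<close>

lemma triangular_eqI: "2 * k = m * (m + 1) \<Longrightarrow> triangular m = k"
  unfolding triangular_def by (metis nonzero_mult_div_cancel_left zero_neq_numeral)

lemma triangular_even:
  "[triangular (2 * m), triangular (2 * m + 1), triangular (2 * m + 2)]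
     = [m * (2 * m + 1), (m + 1) * (2 * m + 1), (m + 1) * (2 * m + 3)]"
  by (intro arg_cong2[where f = Cons] triangular_eqI refl) (simp_all add: algebra_simps)

lemma triangular_odd:
  "[triangular (2 * m + 1), triangular (2 * m + 1 + 1), triangular (2 * m + 1 + 2)]
     = [(2 * m + 1) * (m + 1), (2 * m + 3) * (m + 1), (2 * m + 3) * (m + 2)]"
  by (intro arg_cong2[where f = Cons] triangular_eqI refl) (simp_all add: algebra_simps)

text \<open>Here \<open>s = m\<close>, \<open>r = 2 m + 1\<close>, \<open>p = m + 1\<close>,
  \<open>t = 2 m + 3\<close>, so \<open>s + t - 3 = 3 m\<close>. The box of size 7 by 5 is large
  enough for all uses up to \<open>q = 10\<close>.\<close>

lemma frobenius_triangular_even: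
  fixes m k l q :: nat and F :: "(nat \<times> nat) list"
  assumes "0 < m"
    and "m * k + (2 * m + 3) * l \<le> m * 7" "m * k + (2 * m + 3) * l \<le> (2 * m + 3) * 5"
    and "list_all (\<lambda>i. list_all (\<lambda>j. m * i + (2 * m + 3) * j < m * k + (2 * m + 3) * l
           \<longrightarrow> (i, j) \<in> set F) [0..<5]) [0..<7]"
    and "list_all (\<lambda>(i, j). m * i + (2 * m + 3) * j \<le> m * k + (2 * m + 3) * l) F"
    and "distinct ((k, l) # F)" "length F = q"
  shows "real_of_int (frobenius
             [triangular (2 * m), triangular (2 * m + 1), triangular (2 * m + 2)] q)
           = (real m + 1) * (2 * real m + 1) * ((3 + real k) * real m + (2 * real m + 3) * real l) - 1"
proof -
  have "m * (2 * m + 1) + (m + 1) * (2 * m + 3) = 2 * (m + 1) * (2 * m + 1) + 1"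
    by (simp add: algebra_simps)
  note F = frobenius_eqI_list[OF this _ _ _ _ assms(2-7)]
  have eq: "frobenius [triangular (2 * m), triangular (2 * m + 1), triangular (2 * m + 2)] q
      = int ((m + 1) * (2 * m + 1)) * (int m + int (2 * m + 3) + int (m * k + (2 * m + 3) * l) - 3) - 1"
    unfolding triangular_even by (rule F) (use assms(1) in simp_all)
  show ?thesis unfolding eq by (simp add: algebra_simps)
qed

text \<open>Here \<open>s = 2 m + 1\<close>, \<open>r = m + 1\<close>, \<open>p = 2 m + 3\<close>,
  \<open>t = m + 2\<close>, so again \<open>s + t - 3 = 3 m\<close>.\<close>

lemma frobenius_triangular_odd:
  fixes m k l q :: nat and F :: "(nat \<times> nat) list"
  assumes "(2 * m + 1) * k + (m + 2) * l \<le> (2 * m + 1) * 7"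
      "(2 * m + 1) * k + (m + 2) * l \<le> (m + 2) * 5"
    and "list_all (\<lambda>i. list_all (\<lambda>j. (2 * m + 1) * i + (m + 2) * j < (2 * m + 1) * k + (m + 2) * l
           \<longrightarrow> (i, j) \<in> set F) [0..<5]) [0..<7]"
    and "list_all (\<lambda>(i, j). (2 * m + 1) * i + (m + 2) * j \<le> (2 * m + 1) * k + (m + 2) * l) F"
    and "distinct ((k, l) # F)" "length F = q"
  shows "real_of_int (frobenius
             [triangular (2 * m + 1), triangular (2 * m + 1 + 1), triangular (2 * m + 1 + 2)] q)
           = (real m + 1) * (2 * real m + 3)
               * (3 * real m + (2 * real m + 1) * real k + (real m + 2) * real l) - 1"
proof -
  have "(2 * m + 1) * (m + 1) + (2 * m + 3) * (m + 2) = 2 * (2 * m + 3) * (m + 1) + 1"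
    by (simp add: algebra_simps)
  note F = frobenius_eqI_list[OF this _ _ _ _ assms]
  have eq: "frobenius [triangular (2 * m + 1), triangular (2 * m + 1 + 1), triangular (2 * m + 1 + 2)] q
      = int ((2 * m + 3) * (m + 1)) * (int (2 * m + 1) + int (m + 2)
          + int ((2 * m + 1) * k + (m + 2) * l) - 3) - 1"
    unfolding triangular_odd by (rule F) simp_all
  show ?thesis unfolding eq by (simp add: algebra_simps)
qed

section \<open>Explicit values for \<open>q\<close> from 3 to 10\<close>

lemma frobenius_triangular_even_values:
  fixes n :: nat
  assumes "even n"
  shows "n \<ge> 6 \<Longrightarrow> real_of_int (frobenius [triangular n, triangular (n + 1), triangular (n + 2)] 3)
        = (5 * real n + 6) * (real n + 1) * (real n + 2) / 4 - 1"
      (is "_ \<Longrightarrow> ?eq3")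
    and "n \<ge> 8 \<Longrightarrow> real_of_int (frobenius [triangular n, triangular (n + 1), triangular (n + 2)] 4)
        = 3 * real n * (real n + 1) * (real n + 2) / 2 - 1"
      (is "_ \<Longrightarrow> ?eq4")
    and "n \<ge> 6 \<Longrightarrow> real_of_int (frobenius [triangular n, triangular (n + 1), triangular (n + 2)] 5)
        = 3 * (real n + 1)^2 * (real n + 2) / 2 - 1"
      (is "_ \<Longrightarrow> ?eq5")
    and "n \<ge> 8 \<Longrightarrow> real_of_int (frobenius [triangular n, triangular (n + 1), triangular (n + 2)] 6)
        = 7 * real n * (real n + 1) * (real n + 2) / 4 - 1"
      (is "_ \<Longrightarrow> ?eq6")
    and "n \<ge> 6 \<Longrightarrow> real_of_int (frobenius [triangular n, triangular (n + 1), triangular (n + 2)] 7)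
        = (7 * real n + 6) * (real n + 1) * (real n + 2) / 4 - 1"
      (is "_ \<Longrightarrow> ?eq7")
    and "n \<ge> 12 \<Longrightarrow> real_of_int (frobenius [triangular n, triangular (n + 1), triangular (n + 2)] 8)
        = (7 * real n + 12) * (real n + 1) * (real n + 2) / 4 - 1"
      (is "_ \<Longrightarrow> ?eq8")
    and "n \<ge> 14 \<Longrightarrow> real_of_int (frobenius [triangular n, triangular (n + 1), triangular (n + 2)] 9)
        = 2 * real n * (real n + 1) * (real n + 2) - 1"
      (is "_ \<Longrightarrow> ?eq9")
    and "n = 4 \<or> n \<ge> 8 \<Longrightarrow> real_of_int (frobenius [triangular n, triangular (n + 1), triangular (n + 2)] 10)
        = (4 * real n + 3) * (real n + 1) * (real n + 2) / 2 - 1"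
      (is "_ \<Longrightarrow> ?eq10")
proof -
  obtain m where n: "n = 2 * m" using assms by (elim evenE)
  \<comment> \<open>For \<open>m \<ge> 6\<close> the values begin 0, \<open>m\<close>,
    \<open>2 m\<close>, \<open>2 m + 3\<close>, \<open>3 m\<close>, \<open>3 m + 3\<close>,
    \<open>4 m\<close>, \<open>4 m + 3\<close>, \<open>4 m + 6\<close>, \<open>5 m\<close>,
    \<open>5 m + 3\<close>. Each witness is the pair of index \<open>q\<close>; for smaller
    \<open>m\<close> only comparisons with its value matter.\<close>
  show ?eq3 if "n \<ge> 6"
    using frobenius_triangular_even[of m 0 1
          "[(0, 0), (1, 0), (2, 0)]" 3] that
    unfolding n by (simp add: upt_rec field_simps power2_eq_square)
  show ?eq4 if "n \<ge> 8"
    using frobenius_triangular_even[of m 3 0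
          "[(0, 0), (1, 0), (2, 0), (0, 1)]" 4] that
    unfolding n by (simp add: upt_rec field_simps power2_eq_square)
  show ?eq5 if "n \<ge> 6"
    using frobenius_triangular_even[of m 1 1
          "[(0, 0), (1, 0), (2, 0), (0, 1), (3, 0)]" 5] that
    unfolding n by (simp add: upt_rec field_simps power2_eq_square)
  show ?eq6 if "n \<ge> 8"
    using frobenius_triangular_even[of m 4 0
          "[(0, 0), (1, 0), (2, 0), (0, 1), (3, 0), (1, 1)]" 6] that
    unfolding n by (simp add: upt_rec field_simps power2_eq_square)
  show ?eq7 if "n \<ge> 6"
    using frobenius_triangular_even[of m 2 1
          "[(0, 0), (1, 0), (2, 0), (0, 1), (3, 0), (1, 1), (4, 0)]" 7] that
    unfolding n by (simp add: upt_rec field_simps power2_eq_square)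
  \<comment> \<open>The pair \<open>(5, 0)\<close> stays out of the list because
    \<open>4 m + 6 \<le> 5 m\<close>, that is, \<open>m \<ge> 6\<close>.\<close>
  show ?eq8 if "n \<ge> 12"
    using frobenius_triangular_even[of m 0 2
          "[(0, 0), (1, 0), (2, 0), (0, 1), (3, 0), (1, 1), (4, 0), (2, 1)]" 8] that
    unfolding n by (simp add: upt_rec field_simps power2_eq_square)
  show ?eq9 if "n \<ge> 14"
    using frobenius_triangular_even[of m 5 0
          "[(0, 0), (1, 0), (2, 0), (0, 1), (3, 0), (1, 1), (4, 0), (2, 1), (0, 2)]" 9] that
    unfolding n by (simp add: upt_rec field_simps power2_eq_square)
  show ?eq10 if "n = 4 \<or> n \<ge> 8"
  proof (cases "n = 4") \<comment> \<open>here \<open>6 m < 2 (2 m + 3)\<close>, so the order of the values changes\<close>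
    case True
    then have "m = 2" using n by simp
    then show ?thesis using frobenius_triangular_even[of m 3 1
          "[(0, 0), (1, 0), (2, 0), (3, 0), (0, 1), (4, 0), (1, 1), (5, 0), (2, 1), (6, 0)]" 10]
      unfolding n by (simp add: upt_rec field_simps power2_eq_square)
  next
    case False
    then show ?thesis
      using frobenius_triangular_even[of m 3 1
          "[(0, 0), (1, 0), (2, 0), (0, 1), (3, 0), (1, 1), (4, 0), (2, 1), (0, 2), (5, 0)]" 10] that
      unfolding n by (simp add: upt_rec field_simps power2_eq_square)
  qed
qed

lemma frobenius_triangular_odd_values:
  fixes n :: nat
  assumes "odd n"
  shows "n \<ge> 3 \<Longrightarrow> real_of_int (frobenius [triangular n, triangular (n + 1), triangular (n + 2)] 3)
        = (5 * real n + 3) * (real n + 1) * (real n + 2) / 4 - 1"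
      (is "_ \<Longrightarrow> ?eq3")
    and "n \<ge> 5 \<Longrightarrow> real_of_int (frobenius [triangular n, triangular (n + 1), triangular (n + 2)] 4)
        = 3 * real n * (real n + 1) * (real n + 2) / 2 - 1"
      (is "_ \<Longrightarrow> ?eq4")
    and "n \<ge> 9 \<Longrightarrow> real_of_int (frobenius [triangular n, triangular (n + 1), triangular (n + 2)] 5)
        = 3 * (real n + 1)^2 * (real n + 2) / 2 - 1"
      (is "_ \<Longrightarrow> ?eq5")
    and "n \<ge> 11 \<Longrightarrow> real_of_int (frobenius [triangular n, triangular (n + 1), triangular (n + 2)] 6)
        = (7 * real n - 3) * (real n + 1) * (real n + 2) / 4 - 1"
      (is "_ \<Longrightarrow> ?eq6")
    and "n \<ge> 5 \<Longrightarrow> real_of_int (frobenius [triangular n, triangular (n + 1), triangular (n + 2)] 7)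
        = (7 * real n + 3) * (real n + 1) * (real n + 2) / 4 - 1"
      (is "_ \<Longrightarrow> ?eq7")
    and "n \<ge> 9 \<Longrightarrow> real_of_int (frobenius [triangular n, triangular (n + 1), triangular (n + 2)] 8)
        = (7 * real n + 9) * (real n + 1) * (real n + 2) / 4 - 1"
      (is "_ \<Longrightarrow> ?eq8")
    and "n \<ge> 11 \<Longrightarrow> real_of_int (frobenius [triangular n, triangular (n + 1), triangular (n + 2)] 9)
        = 2 * real n * (real n + 1) * (real n + 2) - 1"
      (is "_ \<Longrightarrow> ?eq9")
    and "n = 3 \<or> n \<ge> 9 \<Longrightarrow> real_of_int (frobenius [triangular n, triangular (n + 1), triangular (n + 2)] 10)
        = (4 * real n + 3) * (real n + 1) * (real n + 2) / 2 - 1"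
      (is "_ \<Longrightarrow> ?eq10")
proof -
  obtain m where n: "n = 2 * m + 1" using assms by (elim oddE)
  \<comment> \<open>For \<open>m \<ge> 4\<close> the values begin 0, \<open>m + 2\<close>,
    \<open>2 m + 1\<close>, \<open>2 m + 4\<close>, \<open>3 m + 3\<close>, \<open>3 m + 6\<close>,
    \<open>4 m + 2\<close>, \<open>4 m + 5\<close>, \<open>4 m + 8\<close>, \<open>5 m + 4\<close>,
    \<open>5 m + 7\<close>.\<close>
  show ?eq3 if "n \<ge> 3"
    using frobenius_triangular_odd[of m 0 2
          "[(0, 0), (0, 1), (1, 0)]" 3] that
    unfolding n by (simp add: upt_rec field_simps power2_eq_square)
  show ?eq4 if "n \<ge> 5"
    using frobenius_triangular_odd[of m 1 1
          "[(0, 0), (0, 1), (1, 0), (0, 2)]" 4] that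
    unfolding n by (simp add: upt_rec field_simps power2_eq_square)
  \<comment> \<open>The pair \<open>(2, 0)\<close> must not precede \<open>(0, 3)\<close>:
    \<open>3 m + 6 \<le> 4 m + 2\<close> means \<open>m \<ge> 4\<close>.\<close>
  show ?eq5 if "n \<ge> 9"
    using frobenius_triangular_odd[of m 0 3
          "[(0, 0), (0, 1), (1, 0), (0, 2), (1, 1)]" 5] that
    unfolding n by (simp add: upt_rec field_simps power2_eq_square)
  show ?eq6 if "n \<ge> 11"
    using frobenius_triangular_odd[of m 2 0
          "[(0, 0), (0, 1), (1, 0), (0, 2), (1, 1), (0, 3)]" 6] that
    unfolding n by (simp add: upt_rec field_simps power2_eq_square)
  show ?eq7 if "n \<ge> 5"
    using frobenius_triangular_odd[of m 1 2
          "[(0, 0), (0, 1), (1, 0), (0, 2), (1, 1), (0, 3), (2, 0)]" 7] that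
    unfolding n by (simp add: upt_rec field_simps power2_eq_square)
  show ?eq8 if "n \<ge> 9"
    using frobenius_triangular_odd[of m 0 4
          "[(0, 0), (0, 1), (1, 0), (0, 2), (1, 1), (0, 3), (2, 0), (1, 2)]" 8] that
    unfolding n by (simp add: upt_rec field_simps power2_eq_square)
  show ?eq9 if "n \<ge> 11"
    using frobenius_triangular_odd[of m 2 1
          "[(0, 0), (0, 1), (1, 0), (0, 2), (1, 1), (0, 3), (2, 0), (1, 2), (0, 4)]" 9] that
    unfolding n by (simp add: upt_rec field_simps power2_eq_square)
  show ?eq10 if "n = 3 \<or> n \<ge> 9"
  proof (cases "n = 3") \<comment> \<open>here \<open>3 (2 m + 1) < (2 m + 1) + 3 (m + 2)\<close>, so the order of the values changes\<close>
    case True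
    then have "m = 1" using n by simp
    \<comment> \<open>Both weights are now 3, so the ten pairs with \<open>i + j \<le> 3\<close>
      come first, and \<open>(0, 4)\<close> ties with the general witness
      \<open>(1, 3)\<close>.\<close>
    then show ?thesis using frobenius_triangular_odd[of m 0 4
          "[(0, 0), (0, 1), (1, 0), (0, 2), (1, 1), (2, 0), (0, 3), (1, 2), (2, 1), (3, 0)]" 10]
      unfolding n by (simp add: upt_rec field_simps power2_eq_square)
  next
    case False
    then show ?thesis
      using frobenius_triangular_odd[of m 1 3
          "[(0, 0), (0, 1), (1, 0), (0, 2), (1, 1), (0, 3), (2, 0), (1, 2), (0, 4), (2, 1)]" 10] that
      unfolding n by (simp add: upt_rec field_simps power2_eq_square)
  qed
qed

theorem theorem4:
  fixes n :: nat
  shows "(odd n \<and> n \<ge> 3 \<longrightarrow>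
       real_of_int (frobenius [triangular n, triangular (n + 1), triangular (n + 2)] 3) =
         (5 * real n + 3) * (real n + 1) * (real n + 2) / 4 - 1) \<and>
     (even n \<and> n \<ge> 6 \<longrightarrow>
       real_of_int (frobenius [triangular n, triangular (n + 1), triangular (n + 2)] 3) =
         (5 * real n + 6) * (real n + 1) * (real n + 2) / 4 - 1) \<and>
     (n = 5 \<or> n \<ge> 7 \<longrightarrow>
       real_of_int (frobenius [triangular n, triangular (n + 1), triangular (n + 2)] 4) =
         3 * real n * (real n + 1) * (real n + 2) / 2 - 1) \<and>
     (n = 6 \<or> n \<ge> 8 \<longrightarrow>
       real_of_int (frobenius [triangular n, triangular (n + 1), triangular (n + 2)] 5) =
         3 * (real n + 1)^2 * (real n + 2) / 2 - 1) \<and>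
     (odd n \<and> n \<ge> 11 \<longrightarrow>
       real_of_int (frobenius [triangular n, triangular (n + 1), triangular (n + 2)] 6) =
         (7 * real n - 3) * (real n + 1) * (real n + 2) / 4 - 1) \<and>
     (even n \<and> n \<ge> 8 \<longrightarrow>
       real_of_int (frobenius [triangular n, triangular (n + 1), triangular (n + 2)] 6) =
         7 * real n * (real n + 1) * (real n + 2) / 4 - 1) \<and>
     (odd n \<and> n \<ge> 5 \<longrightarrow>
       real_of_int (frobenius [triangular n, triangular (n + 1), triangular (n + 2)] 7) =
         (7 * real n + 3) * (real n + 1) * (real n + 2) / 4 - 1) \<and>
     (even n \<and> n \<ge> 6 \<longrightarrow>
       real_of_int (frobenius [triangular n, triangular (n + 1), triangular (n + 2)] 7) =
         (7 * real n + 6) * (real n + 1) * (real n + 2) / 4 - 1) \<and>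
     (odd n \<and> n \<ge> 9 \<longrightarrow>
       real_of_int (frobenius [triangular n, triangular (n + 1), triangular (n + 2)] 8) =
         (7 * real n + 9) * (real n + 1) * (real n + 2) / 4 - 1) \<and>
     (even n \<and> n \<ge> 12 \<longrightarrow>
       real_of_int (frobenius [triangular n, triangular (n + 1), triangular (n + 2)] 8) =
         (7 * real n + 12) * (real n + 1) * (real n + 2) / 4 - 1) \<and>
     (n = 11 \<or> n \<ge> 13 \<longrightarrow>
       real_of_int (frobenius [triangular n, triangular (n + 1), triangular (n + 2)] 9) =
         2 * real n * (real n + 1) * (real n + 2) - 1) \<and>
     (n = 3 \<or> n = 4 \<or> n \<ge> 8 \<longrightarrow>
       real_of_int (frobenius [triangular n, triangular (n + 1), triangular (n + 2)] 10) =
         (4 * real n + 3) * (real n + 1) * (real n + 2) / 2 - 1)"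
proof (cases "even n")
  case True
  \<comment> \<open>Parity closes the gaps in the ranges: \<open>n = 11 \<or> n \<ge> 13\<close>
    becomes \<open>n \<ge> 14\<close> for even \<open>n\<close> and \<open>n \<ge> 11\<close> for
    odd \<open>n\<close>.\<close>
  moreover have "n = 5 \<or> n \<ge> 7 \<Longrightarrow> n \<ge> 8" "n = 6 \<or> n \<ge> 8 \<Longrightarrow> n \<ge> 6" "n = 11 \<or> n \<ge> 13 \<Longrightarrow> n \<ge> 14"
      "n = 3 \<or> n = 4 \<or> n \<ge> 8 \<Longrightarrow> n = 4 \<or> n \<ge> 8"
    using True by presburger+
  ultimately show ?thesis using frobenius_triangular_even_values[OF True] by blast
next
  case False
  moreover have "n = 5 \<or> n \<ge> 7 \<Longrightarrow> n \<ge> 5" "n = 6 \<or> n \<ge> 8 \<Longrightarrow> n \<ge> 9" "n = 11 \<or> n \<ge> 13 \<Longrightarrow> n \<ge> 11"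
      "n = 3 \<or> n = 4 \<or> n \<ge> 8 \<Longrightarrow> n = 3 \<or> n \<ge> 9"
    using False by presburger+
  ultimately show ?thesis using frobenius_triangular_odd_values[OF False] by blast
qed

end
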